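(* Let $E$ be a finite set with $|E|\ge2$, let $K\subseteq\mathbb R_+^E$ be a rational polyhedral cone and suppose that $P=K\cap[0,1]^E=\operatorname{conv}\{0,r^1,\dots,r^m\}$ is a simplex (i.e. $r^1,\dots,r^m$ are linearly independent). Let $Z_j=\{e\in E:r^j_e=0\}$ for $j\in\{1,\dots,m\}$ and $\mathcal Z(P)=\{Z_1,\dots,Z_m\}$. Then $$s(P)=\operatorname{br}_{\cup}(\mathcal Z(P)).$$
   Context: For $y\in\mathbb R_+^E$, $\operatorname{supp}(y)=\{e\in E:y_e>0\}$. For $c\in\mathbb R^E$ let $\alpha(c)=\max\{c^\top y:y\in P\}$. For $c$ with $\alpha(c)>0$ and an integer $\ell\ge1$, $\mathcal B_\ell(c)$ is the family of sets $J\subseteq E$ such that for all $z^1,\dots,z^\ell\in P$: $\left(\bigcap_{i=1}^\ell\operatorname{supp}(z^i)\right)\cap J=\emptyset$ implies $\sum_{i=1}^\ell c^\top z^i\le\alpha(c)(\ell-1)$. $\mathcal B_\infty(c)=\bigcap_{\ell\ge1}\mathcal B_\ell(c)$. The universal stabilization depth of $P$ is $$s(P)=\min\{q\ge1:\ \mathcal B_q(c)=\mathcal B_\infty(c)\text{ for every }c\text{ with }\alpha(c)>0\}.$$ The (semilattice) breadth $\operatorname{br}_{\cup}(\mathcal Z(P))$ is the smallest integer $q\ge1$ such that for every $S\subseteq\{1,\dots,m\}$ there is $T\subseteq S$ with $|T|\le q$ and $\bigcup_{j\in T}Z_j=\bigcup_{j\in S}Z_j$. *)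

theory Defs
  imports "HOL-Analysis.Analysis" "HOL-Library.Extended_Nat"
begin

text \<open>The ground set \<open>E\<close> is the universe of a finite type \<open>'e\<close>; vectors in \<open>\<real>\<^sup>E\<close> have type
  \<open>real ^ 'e\<close> and subsets of \<open>E\<close> have type \<open>'e set\<close>.\<close>

text \<open>A finite system of homogeneous linear inequalities with rational coefficients; the elements
  of \<open>A\<close> are the rows of the system.\<close>

definition rational_polyhedral_cone :: "(real ^ 'e) set \<Rightarrow> bool" where
  "rational_polyhedral_cone K \<longleftrightarrow>
     (\<exists>A. finite A \<and> (\<forall>a\<in>A. \<forall>e. a $ e \<in> \<rat>) \<and> K = {x. \<forall>a\<in>A. a \<bullet> x \<le> 0})"

definition supp :: "real ^ 'e \<Rightarrow> 'e set" where
  "supp y = {e. 0 < y $ e}"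

text \<open>The supremum is a maximum whenever \<open>P\<close> is compact and nonempty.\<close>

definition max_value :: "(real ^ 'e) set \<Rightarrow> real ^ 'e \<Rightarrow> real" where
  "max_value P c = (SUP y\<in>P. c \<bullet> y)"

definition blocking_family :: "(real ^ 'e) set \<Rightarrow> real ^ 'e \<Rightarrow> nat \<Rightarrow> 'e set set" where
  "blocking_family P c l =
     {J. \<forall>z :: nat \<Rightarrow> real ^ 'e. (\<forall>i\<in>{1..l}. z i \<in> P) \<longrightarrow>
           (\<Inter>i\<in>{1..l}. supp (z i)) \<inter> J = {} \<longrightarrow>
           (\<Sum>i=1..l. c \<bullet> z i) \<le> max_value P c * (real l - 1)}"

definition blocking_family_inf :: "(real ^ 'e) set \<Rightarrow> real ^ 'e \<Rightarrow> 'e set set" where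
  "blocking_family_inf P c = (\<Inter>l\<in>{1..}. blocking_family P c l)"

text \<open>The minimum is taken in \<^typ>\<open>enat\<close>, so that the value is \<open>\<infinity>\<close> if no \<open>q\<close> qualifies and is
  the least such \<open>q\<close> otherwise.\<close>

definition stabilization_depth :: "(real ^ 'e) set \<Rightarrow> enat" where
  "stabilization_depth P =
     Inf (enat ` {q. 1 \<le> q \<and>
       (\<forall>c. 0 < max_value P c \<longrightarrow> blocking_family P c q = blocking_family_inf P c)})"

text \<open>Breadth of the finite family \<open>Z 1, \<dots>, Z m\<close> with respect to union. The choice \<open>T = S\<close> shows
  that \<open>q = max 1 m\<close> qualifies, so the least element always exists.\<close>

definition union_breadth :: "nat \<Rightarrow> (nat \<Rightarrow> 'e set) \<Rightarrow> nat" where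
  "union_breadth m Z =
     (LEAST q. 1 \<le> q \<and>
       (\<forall>S. S \<subseteq> {1..m} \<longrightarrow> (\<exists>T. T \<subseteq> S \<and> card T \<le> q \<and> (\<Union>j\<in>T. Z j) = (\<Union>j\<in>S. Z j))))"

end

theory Submission
  imports Defs
begin

text \<open>
  Both sides are least elements of sets of positive integers \<open>q\<close>, and these two sets coincide.

  Fix \<open>c\<close> with \<open>\<alpha> = max_value P c > 0\<close> and call \<open>\<alpha> - c \<bullet> y \<ge> 0\<close> the deficit of a point
  \<open>y\<close> of \<open>P\<close>. Points \<open>z 1, \<dots>, z l\<close> violate the inequality in the definition of the blocking
  family exactly when their total deficit is less than \<open>\<alpha>\<close>. No single deficit then reaches \<open>\<alpha>\<close>,
  so \<open>c \<bullet> z i > 0\<close>, and every \<open>z i\<close> can be replaced by a nonzero vertex \<open>r j\<close> of no larger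
  deficit and no larger support. Conversely, a short list of vertices can be padded with a vertex
  of deficit zero. Hence \<open>J\<close> fails to lie in \<open>blocking_family P c l\<close> if and only if \<open>J\<close> is covered
  by at most \<open>l\<close> of the sets \<open>Z j\<close> whose vertices have total deficit less than \<open>\<alpha>\<close>
  (\<open>not_blocking_iff_cheap_cover\<close>).

  With this description, the breadth property for \<open>q\<close> thins out any cheap cover to a subcover of
  size at most \<open>q\<close>, which is only cheaper; so the families are stable from level \<open>q\<close> on. In the
  other direction, linear independence of the \<open>r j\<close> allows \<open>c \<bullet> r j\<close> to be prescribed. For a nonempty
  index set \<open>S\<close> the choice \<open>c \<bullet> r j = 1\<close> on \<open>S\<close> and \<open>0\<close> off \<open>S\<close> gives deficits \<open>0\<close> and
  \<open>1 = \<alpha>\<close>, so that the cheap covers are exactly those using indices of \<open>S\<close> only. Stability of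
  the family at level \<open>q\<close>, tested on the union of the \<open>Z j\<close> with \<open>j\<close> in \<open>S\<close>, then returns a
  subfamily of size at most \<open>q\<close> with the same union.
\<close>

section \<open>Linear functionals on polytopes\<close>

lemma inner_le_on_convex_hull:
  fixes c :: "'a::real_inner"
  assumes "\<And>v. v \<in> V \<Longrightarrow> c \<bullet> v \<le> b" and "y \<in> convex hull V"
  shows "c \<bullet> y \<le> b"
proof -
  have "convex hull V \<subseteq> {x. c \<bullet> x \<le> b}"
    using assms(1) by (intro hull_minimal convex_halfspace_le) auto
  then show ?thesis
    using assms(2) by blast
qed

lemma max_value_convex_hull:
  fixes V :: "(real ^ 'e) set"
  assumes "finite V" and "V \<noteq> {}"
  shows "max_value (convex hull V) c = Max ((\<bullet>) c ` V)"
proof -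
  let ?M = "Max ((\<bullet>) c ` V)"
  have le: "c \<bullet> y \<le> ?M" if "y \<in> convex hull V" for y
    using inner_le_on_convex_hull[OF _ that] assms(1) by simp
  have "?M \<in> (\<bullet>) c ` V"
    using assms by (intro Max_in) auto
  then have "?M \<in> (\<bullet>) c ` (convex hull V)"
    using hull_subset[of V convex] by blast
  then have "Sup ((\<bullet>) c ` (convex hull V)) = ?M"
    by (rule cSup_eq_maximum) (use le in auto)
  then show ?thesis
    by (simp add: max_value_def)
qed

text \<open>Since \<open>c \<bullet> y\<close> is an average of the values \<open>c \<bullet> v\<close> over the vertices of positive weight, one
  of these vertices does at least as well as \<open>y\<close>; nonnegativity excludes cancellation, so the
  support of such a vertex survives in \<open>y\<close>.\<close>

lemma convex_hull_improving_vertex: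
  fixes V :: "(real ^ 'e) set"
  assumes fin: "finite V" and nonneg: "\<And>v e. v \<in> V \<Longrightarrow> 0 \<le> v $ e"
    and y: "y \<in> convex hull V"
  obtains v where "v \<in> V" and "c \<bullet> y \<le> c \<bullet> v" and "supp v \<subseteq> supp y"
proof -
  obtain u where u: "\<And>v. v \<in> V \<Longrightarrow> 0 \<le> u v" "sum u V = 1" "(\<Sum>v\<in>V. u v *\<^sub>R v) = y"
    using y unfolding convex_hull_finite[OF fin] by auto
  have "\<exists>v\<in>V. 0 < u v \<and> c \<bullet> y \<le> c \<bullet> v"
  proof (rule ccontr)
    assume "\<not> ?thesis"
    then have small: "c \<bullet> v < c \<bullet> y" if "v \<in> V" "0 < u v" for v
      using that by force
    have "\<exists>v\<in>V. u v \<noteq> 0"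
      using u(2) by (metis sum.neutral zero_neq_one)
    then obtain v0 where v0: "v0 \<in> V" "0 < u v0"
      using u(1) by force
    have "c \<bullet> y = (\<Sum>v\<in>V. u v * (c \<bullet> v))"
      by (simp flip: u(3) add: inner_sum_right)
    also have "\<dots> < (\<Sum>v\<in>V. u v * (c \<bullet> y))"
    proof (rule sum_strict_mono_ex1[OF fin])
      show "\<forall>v\<in>V. u v * (c \<bullet> v) \<le> u v * (c \<bullet> y)"
        using u(1) small by (metis less_eq_real_def mult_left_mono mult_zero_left)
      show "\<exists>v\<in>V. u v * (c \<bullet> v) < u v * (c \<bullet> y)"
        using v0 small by (intro bexI[of _ v0]) auto
    qed
    also have "\<dots> = c \<bullet> y"
      using u(2) by (simp flip: sum_distrib_right)
    finally show False by simp
  qed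
  then obtain v where v: "v \<in> V" "0 < u v" "c \<bullet> y \<le> c \<bullet> v" by blast
  have "0 < y $ e" if "0 < v $ e" for e
  proof -
    have "0 < u v * v $ e"
      using v(2) that by simp
    also have "\<dots> \<le> (\<Sum>w\<in>V. u w * w $ e)"
      using v(1) fin u(1) nonneg by (intro member_le_sum[where f = "\<lambda>w. u w * w $ e"]) auto
    also have "\<dots> = y $ e"
      by (simp flip: u(3) add: sum_component)
    finally show ?thesis .
  qed
  then have "supp v \<subseteq> supp y"
    by (auto simp: supp_def)
  with v that show thesis by blast
qed

lemma prescribed_inner_products:
  fixes r :: "'i \<Rightarrow> 'a::euclidean_space" and d :: "'i \<Rightarrow> real"
  assumes "inj_on r I" and "independent (r ` I)"
  obtains c where "\<And>j. j \<in> I \<Longrightarrow> c \<bullet> r j = d j"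
proof -
  obtain g :: "'a \<Rightarrow> real" where g: "linear g" "\<forall>x\<in>r ` I. g x = d (the_inv_into I r x)"
    using linear_independent_extend[OF assms(2), of "\<lambda>x. d (the_inv_into I r x)"] by blast
  have "adjoint g 1 \<bullet> r j = d j" if "j \<in> I" for j
    using adjoint_works[OF g(1), of "r j" 1] g(2) that assms(1)
    by (simp add: inner_commute the_inv_into_f_f)
  with that show thesis by blast
qed

section \<open>Blocking families and cheap covers\<close>

lemma sum_deficit:
  fixes f :: "nat \<Rightarrow> real"
  shows "(\<Sum>i=1..l. f i) \<le> a * (real l - 1) \<longleftrightarrow> a \<le> (\<Sum>i=1..l. a - f i)"
  by (simp add: sum_subtractf algebra_simps)

text \<open>This turns the quantification over points of \<open>P\<close> into one over sets of vertices. Empty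
  intersection of \<open>J\<close> with all supports means that every element of \<open>J\<close> is a zero coordinate
  of some point, which for vertices says that their zero sets cover \<open>J\<close>. A set of indices
  suffices instead of a sequence because repeating a vertex covers nothing new.\<close>

lemma not_blocking_iff_cheap_cover:
  fixes r :: "'i \<Rightarrow> real ^ 'e" and c :: "real ^ 'e"
  assumes fin: "finite I" and nonneg: "\<And>j e. j \<in> I \<Longrightarrow> 0 \<le> r j $ e"
    and P: "P = convex hull (insert 0 (r ` I))" and pos: "0 < max_value P c"
  shows "J \<notin> blocking_family P c l \<longleftrightarrow>
    (\<exists>T. T \<subseteq> I \<and> card T \<le> l \<and> J \<subseteq> (\<Union>j\<in>T. {e. r j $ e = 0}) \<and>
      (\<Sum>j\<in>T. max_value P c - c \<bullet> r j) < max_value P c)"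
    (is "_ \<longleftrightarrow> (\<exists>T. ?cover T)")
proof -
  let ?V = "insert 0 (r ` I)" and ?a = "max_value P c"
  have finV: "finite ?V"
    using fin by simp
  have a: "?a = Max ((\<bullet>) c ` ?V)"
    unfolding P using finV by (intro max_value_convex_hull) auto
  have le: "c \<bullet> y \<le> ?a" if "y \<in> P" for y
  proof (rule inner_le_on_convex_hull)
    show "c \<bullet> v \<le> ?a" if "v \<in> ?V" for v
      unfolding a using that finV by (intro Max_ge) auto
    show "y \<in> convex hull ?V"
      using that P by simp
  qed
  have rP: "r j \<in> P" if "j \<in> I" for j
    unfolding P using that by (intro hull_inc) auto
  have supp_r: "supp (r j) = - {e. r j $ e = 0}" if "j \<in> I" for j
    using nonneg[OF that] by (auto simp: supp_def less_le)
  have "?a \<in> (\<bullet>) c ` ?V"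
    unfolding a using finV by (intro Max_in) auto
  then obtain k where k: "k \<in> I" "c \<bullet> r k = ?a"
    using pos by auto
  have vertex: "\<exists>j\<in>I. c \<bullet> y \<le> c \<bullet> r j \<and> supp (r j) \<subseteq> supp y" if "y \<in> P" "0 < c \<bullet> y" for y
  proof -
    obtain v where v: "v \<in> ?V" "c \<bullet> y \<le> c \<bullet> v" "supp v \<subseteq> supp y"
      using convex_hull_improving_vertex[of ?V y c] finV nonneg \<open>y \<in> P\<close> unfolding P
      by (metis (no_types, lifting) image_iff insert_iff order_refl zero_index)
    then show ?thesis
      using that(2) by auto
  qed
  show ?thesis
  proof
    assume "J \<notin> blocking_family P c l"
    then obtain z where zP: "\<forall>i\<in>{1..l}. z i \<in> P"
      and zJ: "(\<Inter>i\<in>{1..l}. supp (z i)) \<inter> J = {}"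
      and zsum: "(\<Sum>i=1..l. ?a - c \<bullet> z i) < ?a"
      unfolding blocking_family_def sum_deficit by (auto simp: not_le)
    have "0 < c \<bullet> z i" if i: "i \<in> {1..l}" for i
    proof -
      have "?a - c \<bullet> z i \<le> (\<Sum>i=1..l. ?a - c \<bullet> z i)"
        using i le zP by (intro member_le_sum[where f = "\<lambda>i. ?a - c \<bullet> z i"]) auto
      with zsum show ?thesis by linarith
    qed
    then have "\<forall>i\<in>{1..l}. \<exists>j\<in>I. c \<bullet> z i \<le> c \<bullet> r j \<and> supp (r j) \<subseteq> supp (z i)"
      using vertex zP by blast
    then obtain f where f: "\<And>i. i \<in> {1..l} \<Longrightarrow> f i \<in> I"
      "\<And>i. i \<in> {1..l} \<Longrightarrow> c \<bullet> z i \<le> c \<bullet> r (f i)"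
      "\<And>i. i \<in> {1..l} \<Longrightarrow> supp (r (f i)) \<subseteq> supp (z i)"
      by metis
    let ?T = "f ` {1..l}"
    have "J \<subseteq> (\<Union>j\<in>?T. {e. r j $ e = 0})"
    proof
      fix e assume "e \<in> J"
      then obtain i where i: "i \<in> {1..l}" "e \<notin> supp (z i)"
        using zJ by blast
      then have "e \<notin> supp (r (f i))"
        using f(3) by blast
      then show "e \<in> (\<Union>j\<in>?T. {e. r j $ e = 0})"
        using i(1) supp_r[OF f(1)] by auto
    qed
    moreover have "(\<Sum>j\<in>?T. ?a - c \<bullet> r j) < ?a"
    proof -
      \<comment> \<open>The map \<open>f\<close> may repeat vertices; merging repetitions only lowers the total deficit.\<close>
      have "(\<Sum>j\<in>?T. ?a - c \<bullet> r j) \<le> (\<Sum>i=1..l. ?a - c \<bullet> r (f i))"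
        using sum_image_le[of "{1..l}" "\<lambda>j. ?a - c \<bullet> r j" f] f(1) le rP by (simp add: o_def)
      also have "\<dots> \<le> (\<Sum>i=1..l. ?a - c \<bullet> z i)"
        using f(2) by (intro sum_mono) simp
      finally show ?thesis
        using zsum by linarith
    qed
    moreover have "?T \<subseteq> I" "card ?T \<le> l"
      using f(1) card_image_le[of "{1..l}" f] by auto
    ultimately show "\<exists>T. ?cover T" by blast
  next
    assume "\<exists>T. ?cover T"
    then obtain T where T: "T \<subseteq> I" "card T \<le> l" "J \<subseteq> (\<Union>j\<in>T. {e. r j $ e = 0})"
      "(\<Sum>j\<in>T. ?a - c \<bullet> r j) < ?a" by blast
    obtain h where h: "bij_betw h {1..card T} T"
      using finite_subset[OF T(1) fin] ex_bij_betw_nat_finite_1 by blast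
    \<comment> \<open>Padding with the optimal vertex \<open>r k\<close> adds no deficit and only shrinks the common support.\<close>
    define z where "z i = (if i \<le> card T then r (h i) else r k)" for i
    have hI: "h i \<in> I" if "i \<in> {1..card T}" for i
      using bij_betwE[OF h] that T(1) by blast
    have "z i \<in> P" if "i \<in> {1..l}" for i
      using that hI k(1) by (auto simp: z_def intro!: rP)
    moreover have "(\<Inter>i\<in>{1..l}. supp (z i)) \<inter> J = {}"
    proof -
      have False if e: "e \<in> J" "\<And>i. i \<in> {1..l} \<Longrightarrow> e \<in> supp (z i)" for e
      proof -
        obtain j where j: "j \<in> T" "r j $ e = 0"
          using T(3) e(1) by blast
        then obtain i where i: "i \<in> {1..card T}" "h i = j"
          using bij_betw_imp_surj_on[OF h] by (metis imageE)
        have "e \<in> supp (z i)"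
          using i(1) T(2) by (intro e(2)) simp
        then show False
          using i j(2) by (simp add: z_def supp_def)
      qed
      then show ?thesis by blast
    qed
    moreover have "(\<Sum>i=1..l. ?a - c \<bullet> z i) < ?a"
    proof -
      have "(\<Sum>i=1..l. ?a - c \<bullet> z i) = (\<Sum>i=1..card T. ?a - c \<bullet> z i)"
        using T(2) k(2) by (intro sum.mono_neutral_right) (auto simp: z_def)
      also have "\<dots> = (\<Sum>i=1..card T. ?a - c \<bullet> r (h i))"
        by (intro sum.cong) (auto simp: z_def)
      also have "\<dots> = (\<Sum>j\<in>T. ?a - c \<bullet> r j)"
        by (rule sum.reindex_bij_betw[OF h])
      finally show ?thesis
        using T(4) by simp
    qed
    ultimately show "J \<notin> blocking_family P c l"
      unfolding blocking_family_def sum_deficit by (auto simp: not_le intro!: exI[of _ z])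
  qed
qed

section \<open>Stabilization and breadth\<close>

text \<open>Deficits are nonnegative, so passing to a subcover keeps a cover cheap; this gives stability
  from the breadth bound. Conversely, an objective with deficits \<open>0\<close> on \<open>S\<close> and \<open>\<alpha>\<close> off \<open>S\<close>
  restricts cheap covers to \<open>S\<close>, so that stability has to produce a small cover from within
  \<open>S\<close>.\<close>

lemma stable_iff_breadth_bound:
  fixes r :: "'i \<Rightarrow> real ^ 'e"
  assumes fin: "finite I" and nonneg: "\<And>j e. j \<in> I \<Longrightarrow> 0 \<le> r j $ e"
    and P: "P = convex hull (insert 0 (r ` I))"
    and inj: "inj_on r I" and indep: "independent (r ` I)"
    and Z: "\<And>j. j \<in> I \<Longrightarrow> Z j = {e. r j $ e = 0}" and q: "1 \<le> q"
  shows "(\<forall>c. 0 < max_value P c \<longrightarrow> blocking_family P c q = blocking_family_inf P c) \<longleftrightarrow>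
    (\<forall>S. S \<subseteq> I \<longrightarrow> (\<exists>T. T \<subseteq> S \<and> card T \<le> q \<and> (\<Union>j\<in>T. Z j) = (\<Union>j\<in>S. Z j)))"
    (is "?stable \<longleftrightarrow> ?bound")
proof -
  have cover_Z: "(\<Union>j\<in>T. {e. r j $ e = 0}) = (\<Union>j\<in>T. Z j)" if "T \<subseteq> I" for T
    using that Z by (intro SUP_cong) auto
  have not_blocking: "J \<notin> blocking_family P c l \<longleftrightarrow>
      (\<exists>T. T \<subseteq> I \<and> card T \<le> l \<and> J \<subseteq> (\<Union>j\<in>T. Z j) \<and>
        (\<Sum>j\<in>T. max_value P c - c \<bullet> r j) < max_value P c)"
    if "0 < max_value P c" for c J l
  proof -
    have "J \<notin> blocking_family P c l \<longleftrightarrow>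
      (\<exists>T. T \<subseteq> I \<and> card T \<le> l \<and> J \<subseteq> (\<Union>j\<in>T. {e. r j $ e = 0}) \<and>
        (\<Sum>j\<in>T. max_value P c - c \<bullet> r j) < max_value P c)"
      using fin nonneg P that by (rule not_blocking_iff_cheap_cover)
    also have "\<dots> \<longleftrightarrow> (\<exists>T. T \<subseteq> I \<and> card T \<le> l \<and> J \<subseteq> (\<Union>j\<in>T. Z j) \<and>
        (\<Sum>j\<in>T. max_value P c - c \<bullet> r j) < max_value P c)"
      by (intro ex_cong1 conj_cong refl) (simp add: cover_Z)
    finally show ?thesis .
  qed
  have maxV: "max_value P c = Max ((\<bullet>) c ` insert 0 (r ` I))" for c
    unfolding P using fin by (intro max_value_convex_hull) auto
  show ?thesis
  proof
    assume stable: ?stable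
    show ?bound
    proof (intro allI impI)
      fix S assume S: "S \<subseteq> I"
      show "\<exists>T. T \<subseteq> S \<and> card T \<le> q \<and> (\<Union>j\<in>T. Z j) = (\<Union>j\<in>S. Z j)"
      proof (cases "S = {}")
        case False
        obtain c where c: "\<And>j. j \<in> I \<Longrightarrow> c \<bullet> r j = (if j \<in> S then 1 else 0)"
          using prescribed_inner_products[OF inj indep,
              of "\<lambda>j. if j \<in> S then 1 else 0"] by blast
        obtain s where s: "s \<in> S"
          using False by blast
        have "(1::real) \<in> (\<bullet>) c ` insert 0 (r ` I)"
          using s S c[of s] by (auto intro!: rev_image_eqI[of "r s"])
        then have a: "max_value P c = 1"
          unfolding maxV using fin c by (intro Max_eqI) auto
        have "(\<Union>j\<in>S. Z j) \<notin> blocking_family P c (card S)"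
          using S a c by (subst not_blocking) (auto intro!: exI[of _ S] simp: subset_iff)
        moreover have "1 \<le> card S"
          using s S fin by (metis One_nat_def Suc_leI card_gt_0_iff empty_iff finite_subset)
        ultimately have "(\<Union>j\<in>S. Z j) \<notin> blocking_family_inf P c"
          unfolding blocking_family_inf_def by blast
        then have "(\<Union>j\<in>S. Z j) \<notin> blocking_family P c q"
          using stable a by simp
        then obtain T where T: "T \<subseteq> I" "card T \<le> q" "(\<Union>j\<in>S. Z j) \<subseteq> (\<Union>j\<in>T. Z j)"
          "(\<Sum>j\<in>T. 1 - c \<bullet> r j) < 1"
          using a by (subst (asm) not_blocking) auto
        have "j \<in> S" if j: "j \<in> T" for j
        proof (rule ccontr)
          assume "j \<notin> S"
          then have "1 = 1 - c \<bullet> r j"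
            using c j T(1) by auto
          also have "\<dots> \<le> (\<Sum>j\<in>T. 1 - c \<bullet> r j)"
            using j T(1) c finite_subset[OF T(1) fin]
            by (intro member_le_sum[where f = "\<lambda>j. 1 - c \<bullet> r j"]) auto
          finally show False
            using T(4) by simp
        qed
        then have "T \<subseteq> S" by blast
        with T(2,3) show ?thesis by blast
      qed auto
    qed
  next
    assume bound: ?bound
    show ?stable
    proof (intro allI impI)
      fix c assume pos: "0 < max_value P c"
      have "J \<notin> blocking_family P c q" if J: "J \<notin> blocking_family P c l" for J l
      proof -
        obtain S where S: "S \<subseteq> I" "J \<subseteq> (\<Union>j\<in>S. Z j)"
          "(\<Sum>j\<in>S. max_value P c - c \<bullet> r j) < max_value P c"
          using iffD1[OF not_blocking[OF pos] J] by blast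
        obtain T where T: "T \<subseteq> S" "card T \<le> q" "(\<Union>j\<in>T. Z j) = (\<Union>j\<in>S. Z j)"
          using bound[rule_format, OF S(1)] by metis
        have "c \<bullet> r j \<le> max_value P c" if "j \<in> S" for j
          unfolding maxV using that S(1) fin by (intro Max_ge) auto
        then have "(\<Sum>j\<in>T. max_value P c - c \<bullet> r j) \<le> (\<Sum>j\<in>S. max_value P c - c \<bullet> r j)"
          using T(1) finite_subset[OF S(1) fin] by (intro sum_mono2) auto
        then have "(\<Sum>j\<in>T. max_value P c - c \<bullet> r j) < max_value P c"
          using S(3) by linarith
        with S(1,2) T show ?thesis
          by (intro iffD2[OF not_blocking[OF pos]] exI[of _ T]) auto
      qed
      then show "blocking_family P c q = blocking_family_inf P c"
        using q unfolding blocking_family_inf_def by blast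
    qed
  qed
qed

lemma Inf_enat_image_eq_Least:
  assumes "\<exists>q. p q"
  shows "Inf (enat ` {q. p q}) = enat (LEAST q. p q)"
proof (rule cInf_eq_minimum)
  show "enat (LEAST q. p q) \<in> enat ` {q. p q}"
    using assms by (auto intro: LeastI_ex)
qed (auto intro: Least_le)

theorem theorem3p4:
  fixes K P :: "(real ^ 'e) set" and r :: "nat \<Rightarrow> real ^ 'e" and m :: nat
    and Z :: "nat \<Rightarrow> 'e set"
  assumes "CARD('e) \<ge> 2"
    and "rational_polyhedral_cone K"
    and "K \<subseteq> {x. \<forall>e. 0 \<le> x $ e}"
    and "P = K \<inter> {x. \<forall>e. 0 \<le> x $ e \<and> x $ e \<le> 1}"
    and "P = convex hull (insert 0 (r ` {1..m}))"
    and "inj_on r {1..m}" and "independent (r ` {1..m})"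
    and "\<And>j. j \<in> {1..m} \<Longrightarrow> Z j = {e. r j $ e = 0}"
  shows "stabilization_depth P = enat (union_breadth m Z)"
proof -
  let ?bound = "\<lambda>q. 1 \<le> q \<and>
    (\<forall>S. S \<subseteq> {1..m} \<longrightarrow> (\<exists>T. T \<subseteq> S \<and> card T \<le> q \<and> (\<Union>j\<in>T. Z j) = (\<Union>j\<in>S. Z j)))"
  have nonneg: "0 \<le> r j $ e" if "j \<in> {1..m}" for j e
  proof -
    have "r j \<in> P"
      unfolding assms(5) using that by (intro hull_inc) auto
    then show ?thesis
      using assms(4) by blast
  qed
  have "?bound (max 1 m)"
  proof (intro conjI allI impI)
    fix S assume "S \<subseteq> {1..m}"
    then have "card S \<le> max 1 m"
      using card_mono[of "{1..m}" S] by simp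
    then show "\<exists>T. T \<subseteq> S \<and> card T \<le> max 1 m \<and> (\<Union>j\<in>T. Z j) = (\<Union>j\<in>S. Z j)"
      by blast
  qed simp
  then have "\<exists>q. ?bound q"
    by (rule exI)
  then have "Inf (enat ` {q. ?bound q}) = enat (union_breadth m Z)"
    unfolding union_breadth_def by (rule Inf_enat_image_eq_Least)
  moreover have "1 \<le> q \<and>
      (\<forall>c. 0 < max_value P c \<longrightarrow> blocking_family P c q = blocking_family_inf P c) \<longleftrightarrow> ?bound q"
    for q
    using stable_iff_breadth_bound[where r = r and I = "{1..m}" and Z = Z and q = q,
        OF finite_atLeastAtMost nonneg assms(5-8)]
    by (intro conj_cong refl) simp
  ultimately show ?thesis
    unfolding stabilization_depth_def by simp
qed

end
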